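(* Let $\Gamma$ be an infinite, locally finite, connected, unweighted graph which is quasi-transitive and not bipartite. Then $\bar h(\Gamma)\le 1-\delta$, where $\delta=\delta(d(\Gamma),\sharp\mathcal I,OG(\Gamma))>0$ depends only on $d(\Gamma)$, $\sharp\mathcal I$ and $OG(\Gamma)$.
   Context: Unweighted means $\mu_{xy}=1$ if $x\sim y$ and $\mu_{xy}=0$ otherwise; the general setting permits self-loops ($x\sim x$). $\mathrm{Aut}(\Gamma)$ is the group of all self-isometries of the vertex set with the graph distance. The orbits of the vertex set under $\mathrm{Aut}(\Gamma)$ are denoted $\{O_i\}_{i\in\mathcal I}$; $\Gamma$ is quasi-transitive if the number of orbits $\sharp\mathcal I$ is finite. $d_x=\sum_y\mu_{xy}$ is the degree of $x$ and $d(\Gamma)=\max_x d_x$ is the maximal vertex degree. A cycle of length $n$ is a closed path $x_0\sim x_1\sim\cdots\sim x_{n-1}\sim x_0$, and $OG(\Gamma)$ is the odd girth: the length of a shortest odd cycle ($\infty$ if there is none, i.e. if $\Gamma$ is bipartite). The dual Cheeger constant is $\bar h(\Gamma)=\sup\left\{\frac{2|E(V_1,V_2)|}{\mathrm{vol}(V_1)+\mathrm{vol}(V_2)}\right\}$ over pairs of disjoint nonempty finite subsets $V_1,V_2$ of the vertex set, where $|E(V_1,V_2)|=\sum_{x\in V_1}\sum_{y\in V_2}\mu_{xy}$ is the number of edges between $V_1$ and $V_2$ and $\mathrm{vol}(U)$ is the sum of the degrees of the vertices in $U$.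
   Formalization: Aut(Γ) is taken to be the self-isometries that also preserve self-loops (with distance alone the claim fails for the integer line with one loop); δ is chosen for a fixed vertex type, which suffices since such graphs are countable. *)

theory Defs
  imports Complex_Main "HOL-Library.Extended_Nat"
begin

text \<open>
  An unweighted graph is given by its vertex set \<open>V\<close> and its adjacency relation \<open>E\<close>, where
  \<open>(x, y) \<in> E\<close> means $x \sim y$. Self-loops \<open>(x, x) \<in> E\<close> are permitted. Since \<open>E\<close> is a relation,
  \<open>(x, y) \<in> E ^^ n\<close> says that there is a path $x = x_0 \sim x_1 \sim \cdots \sim x_n = y$.
\<close>

definition graph :: "'a set \<Rightarrow> ('a \<times> 'a) set \<Rightarrow> bool" where
  "graph V E \<longleftrightarrow> E \<subseteq> V \<times> V \<and> sym E"

definition locally_finite :: "'a set \<Rightarrow> ('a \<times> 'a) set \<Rightarrow> bool" where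
  "locally_finite V E \<longleftrightarrow> (\<forall>x\<in>V. finite (E `` {x}))"

definition connected_graph :: "'a set \<Rightarrow> ('a \<times> 'a) set \<Rightarrow> bool" where
  "connected_graph V E \<longleftrightarrow> (\<forall>x\<in>V. \<forall>y\<in>V. (x, y) \<in> E\<^sup>*)"

definition bipartite :: "'a set \<Rightarrow> ('a \<times> 'a) set \<Rightarrow> bool" where
  "bipartite V E \<longleftrightarrow>
     (\<exists>A B. A \<union> B = V \<and> A \<inter> B = {} \<and>
        (\<forall>(x, y)\<in>E. x \<in> A \<and> y \<in> B \<or> x \<in> B \<and> y \<in> A))"

definition edge_weight :: "('a \<times> 'a) set \<Rightarrow> 'a \<Rightarrow> 'a \<Rightarrow> nat" where
  "edge_weight E x y = (if (x, y) \<in> E then 1 else 0)"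

text \<open>
  The sum of the weights runs over the neighbours only: a sum over the infinite vertex set would
  be \<open>0\<close> by convention. A self-loop contributes 1.
\<close>

definition degree :: "('a \<times> 'a) set \<Rightarrow> 'a \<Rightarrow> nat" where
  "degree E x = (\<Sum>y\<in>E `` {x}. edge_weight E x y)"

text \<open>
  In a locally finite quasi-transitive graph only finitely many degrees occur, so that \<open>Max\<close> is
  meaningful although \<open>V\<close> is infinite.
\<close>

definition max_degree :: "'a set \<Rightarrow> ('a \<times> 'a) set \<Rightarrow> nat" where
  "max_degree V E = Max (degree E ` V)"

definition odd_girth :: "'a set \<Rightarrow> ('a \<times> 'a) set \<Rightarrow> enat" where
  "odd_girth V E = Inf {enat n | n. odd n \<and> (\<exists>x\<in>V. (x, x) \<in> E ^^ n)}"

definition graph_dist :: "('a \<times> 'a) set \<Rightarrow> 'a \<Rightarrow> 'a \<Rightarrow> nat" where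
  "graph_dist E x y = (LEAST n. (x, y) \<in> E ^^ n)"

definition self_isometries :: "'a set \<Rightarrow> ('a \<times> 'a) set \<Rightarrow> ('a \<Rightarrow> 'a) set" where
  "self_isometries V E =
     {f. bij_betw f V V \<and> (\<forall>x\<in>V. \<forall>y\<in>V. graph_dist E (f x) (f y) = graph_dist E x y)}"

text \<open>
  The distance does not see self-loops, so automorphisms are the self-isometries that respect them.
  Without self-loops this is no restriction (\<open>automorphisms_loopfree\<close>). With self-loops it is needed
  for quasi-transitivity to say anything about them: the bi-infinite path with a single loop added at
  one vertex is not bipartite, and its self-isometries act transitively, but its dual Cheeger
  constant is 1.
\<close>

definition automorphisms :: "'a set \<Rightarrow> ('a \<times> 'a) set \<Rightarrow> ('a \<Rightarrow> 'a) set" where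
  "automorphisms V E =
     {f \<in> self_isometries V E. \<forall>x\<in>V. (f x, f x) \<in> E \<longleftrightarrow> (x, x) \<in> E}"

lemma automorphisms_loopfree:
  assumes "irrefl E"
  shows "automorphisms V E = self_isometries V E"
  using assms by (auto simp: automorphisms_def irrefl_def)

definition orbits :: "'a set \<Rightarrow> ('a \<times> 'a) set \<Rightarrow> 'a set set" where
  "orbits V E = (\<lambda>x. {f x | f. f \<in> automorphisms V E}) ` V"

definition quasi_transitive :: "'a set \<Rightarrow> ('a \<times> 'a) set \<Rightarrow> bool" where
  "quasi_transitive V E \<longleftrightarrow> finite (orbits V E)"

definition edges_between :: "('a \<times> 'a) set \<Rightarrow> 'a set \<Rightarrow> 'a set \<Rightarrow> nat" where
  "edges_between E A B = (\<Sum>x\<in>A. \<Sum>y\<in>B. edge_weight E x y)"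

definition vol :: "('a \<times> 'a) set \<Rightarrow> 'a set \<Rightarrow> nat" where
  "vol E U = (\<Sum>x\<in>U. degree E x)"

text \<open>
  For an infinite, locally finite, connected graph the set of quotients is nonempty and bounded
  above by 1, so the supremum in the reals is the genuine one.
\<close>

definition dual_cheeger :: "'a set \<Rightarrow> ('a \<times> 'a) set \<Rightarrow> real" where
  "dual_cheeger V E =
     Sup {2 * real (edges_between E A B) / (real (vol E A) + real (vol E B)) | A B.
            A \<subseteq> V \<and> B \<subseteq> V \<and> A \<inter> B = {} \<and> A \<noteq> {} \<and> B \<noteq> {} \<and> finite A \<and> finite B}"

end

theory Submission
  imports Defs
begin

text \<open>
  Let \<open>g\<close> be the odd girth, \<open>k\<close> the number of orbits and \<open>d\<close> the maximal degree. The quotient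
  \<open>2 * |E(A, B)| / (vol A + vol B)\<close> falls short of 1 because of the edges that leave a vertex of
  \<open>A\<close> without ending in \<open>B\<close>, or leave a vertex of \<open>B\<close> without ending in \<open>A\<close>; call a starting
  point of such an edge defective. It suffices that a positive proportion of the vertices of
  \<open>A \<union> B\<close>, bounded below in terms of \<open>d\<close>, \<open>k\<close>, \<open>g\<close>, is defective.

  Quasi-transitivity spreads odd closed walks over the whole graph. The vertices that lie on a
  closed walk of length \<open>g + 2 * n\<close> form a union of orbits that also contains, once \<open>n\<close> is
  increased by one, all neighbours of its elements. By connectedness it gains an orbit at each step
  until it is the whole vertex set, so every vertex lies on a closed walk of the odd length
  \<open>L = g + 2 * k\<close> (\<open>odd_closed_walk_everywhere\<close>).

  A walk that starts in \<open>A \<union> B\<close> and meets no defective vertex alternates between the disjoint sets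
  \<open>A\<close> and \<open>B\<close>, and so cannot close up after an odd number of steps. Hence each vertex of \<open>A \<union> B\<close>
  has a defective vertex at fewer than \<open>L\<close> steps (\<open>defective_vertex_nearby\<close>). As at most
  \<open>N = (\<Sum>i<L. d ^ i)\<close> vertices are that close to a given one, the defective vertices are at least
  \<open>card (A \<union> B) / N\<close> in number, and the quotient is at most \<open>1 - 1 / (d * N)\<close>.
\<close>

section \<open>Walks\<close>

lemma relpow_sym:
  assumes "sym E" "(x, y) \<in> E ^^ n"
  shows "(y, x) \<in> E ^^ n"
  using assms(2)
proof (induction n arbitrary: y)
  case (Suc n)
  then obtain z where "(x, z) \<in> E ^^ n" "(z, y) \<in> E" by auto
  with Suc.IH assms(1) have "(z, x) \<in> E ^^ n" "(y, z) \<in> E" by (auto dest: symD)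
  then show ?case by (rule relpow_Suc_I2[rotated])
qed simp

lemma relpow_trans:
  assumes "(x, y) \<in> E ^^ m" "(y, z) \<in> E ^^ n"
  shows "(x, z) \<in> E ^^ (m + n)"
  using assms by (auto simp: relpow_add)

lemma relpow_in_vertices:
  assumes "graph V E" "(x, y) \<in> E ^^ n" "x \<in> V"
  shows "y \<in> V"
  using assms by (cases n) (auto simp: graph_def)

lemma connected_walk_exists:
  assumes "connected_graph V E" "x \<in> V" "y \<in> V"
  obtains n where "(x, y) \<in> E ^^ n"
  using assms rtrancl_imp_relpow unfolding connected_graph_def by metis

lemma degree_eq_card:
  shows "degree E x = card (E `` {x})"
  by (simp add: degree_def edge_weight_def)

text \<open>A walk of length \<open>i\<close> is a sequence of \<open>i\<close> choices among at most \<open>d\<close> neighbours.\<close>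

lemma card_relpow_Image_le:
  assumes "graph V E" "locally_finite V E" "\<And>x. x \<in> V \<Longrightarrow> degree E x \<le> d" "u \<in> V"
  shows "finite ((E ^^ i) `` {u}) \<and> card ((E ^^ i) `` {u}) \<le> d ^ i"
proof (induction i)
  case (Suc i)
  let ?S = "(E ^^ i) `` {u}"
  have eq: "(E ^^ Suc i) `` {u} = (\<Union>v\<in>?S. E `` {v})" by auto
  have V: "v \<in> V" if "v \<in> ?S" for v
    using that relpow_in_vertices[OF assms(1) _ assms(4)] by auto
  have fin: "finite ((E ^^ Suc i) `` {u})"
    unfolding eq using Suc V assms(2) by (auto simp: locally_finite_def)
  have "card ((E ^^ Suc i) `` {u}) \<le> (\<Sum>v\<in>?S. card (E `` {v}))"
    unfolding eq using Suc by (intro card_UN_le) auto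
  also have "\<dots> \<le> (\<Sum>v\<in>?S. d)"
    using V assms(3) by (intro sum_mono) (simp add: degree_eq_card)
  also have "\<dots> \<le> d ^ i * d" using Suc by simp
  finally show ?case using fin by (simp add: mult.commute)
qed simp

section \<open>Automorphisms and orbits\<close>

text \<open>Distance 1 means being adjacent and distinct; adjacency of a vertex to itself is respected by
  the extra condition on automorphisms.\<close>

lemma automorphism_edge_iff:
  assumes "connected_graph V E" "f \<in> automorphisms V E" "x \<in> V" "y \<in> V"
  shows "(f x, f y) \<in> E \<longleftrightarrow> (x, y) \<in> E"
proof (cases "x = y")
  case True
  with assms show ?thesis by (auto simp: automorphisms_def)
next
  case False
  have bij: "bij_betw f V V" and d: "graph_dist E (f x) (f y) = graph_dist E x y"
    using assms by (auto simp: automorphisms_def self_isometries_def)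
  have fV: "f x \<in> V" "f y \<in> V" and ne: "f x \<noteq> f y"
    using bij assms False by (auto simp: bij_betw_def inj_on_def)
  have dist_1: "(a, b) \<in> E \<longleftrightarrow> graph_dist E a b = 1"
    if ab: "a \<in> V" "b \<in> V" "a \<noteq> b" for a b
  proof
    assume "(a, b) \<in> E"
    then show "graph_dist E a b = 1" unfolding graph_dist_def
    proof (intro Least_equality)
      fix n assume "(a, b) \<in> E ^^ n"
      with ab show "1 \<le> n" by (cases n) auto
    qed simp
  next
    assume 1: "graph_dist E a b = 1"
    obtain n where "(a, b) \<in> E ^^ n" using connected_walk_exists[OF assms(1) ab(1,2)] .
    then have "(a, b) \<in> E ^^ graph_dist E a b" unfolding graph_dist_def by (rule LeastI)
    with 1 show "(a, b) \<in> E" by simp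
  qed
  show ?thesis using dist_1[OF fV ne] dist_1[OF assms(3,4) False] d by simp
qed

lemma automorphism_relpow:
  assumes "graph V E" "connected_graph V E" "f \<in> automorphisms V E" "x \<in> V" "(x, y) \<in> E ^^ n"
  shows "(f x, f y) \<in> E ^^ n"
  using assms(5)
proof (induction n arbitrary: y)
  case (Suc n)
  then obtain z where z: "(x, z) \<in> E ^^ n" "(z, y) \<in> E" by auto
  then have "z \<in> V" "y \<in> V" using assms(1) by (auto simp: graph_def)
  with z Suc.IH automorphism_edge_iff[OF assms(2,3)] show ?case by (meson relpow_Suc_I)
qed simp

lemma automorphism_degree:
  assumes "graph V E" "connected_graph V E" "f \<in> automorphisms V E" "x \<in> V"
  shows "degree E (f x) = degree E x"
proof -
  have bij: "bij_betw f V V"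
    using assms(3) by (auto simp: automorphisms_def self_isometries_def)
  have "E `` {f x} = f ` (E `` {x})"
  proof
    show "f ` (E `` {x}) \<subseteq> E `` {f x}"
      using assms automorphism_edge_iff[OF assms(2,3,4)] by (auto simp: graph_def)
    show "E `` {f x} \<subseteq> f ` (E `` {x})"
    proof
      fix w assume w: "w \<in> E `` {f x}"
      then have "w \<in> f ` V" using assms(1) bij by (auto simp: graph_def bij_betw_def)
      then obtain v where "v \<in> V" "w = f v" by auto
      with w show "w \<in> f ` (E `` {x})"
        using automorphism_edge_iff[OF assms(2,3,4)] by auto
    qed
  qed
  moreover have "inj_on f (E `` {x})"
    using bij assms(1) by (auto simp: bij_betw_def graph_def intro: inj_on_subset)
  ultimately show ?thesis by (simp add: degree_eq_card card_image)
qed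

definition orbit :: "'a set \<Rightarrow> ('a \<times> 'a) set \<Rightarrow> 'a \<Rightarrow> 'a set" where
  "orbit V E x = {f x | f. f \<in> automorphisms V E}"

lemma orbits_eq: "orbits V E = orbit V E ` V"
  by (simp add: orbits_def orbit_def)

lemma orbit_refl: "x \<in> orbit V E x"
proof -
  have "id \<in> automorphisms V E" by (simp add: automorphisms_def self_isometries_def)
  then show ?thesis unfolding orbit_def by (intro CollectI exI[of _ id]) simp
qed

lemma degree_le_max_degree:
  assumes "graph V E" "connected_graph V E" "quasi_transitive V E" "x \<in> V"
  shows "degree E x \<le> max_degree V E"
proof -
  have "degree E ` V \<subseteq> (\<lambda>O'. degree E (SOME y. y \<in> O')) ` orbits V E"
  proof
    fix n assume "n \<in> degree E ` V"
    then obtain y where y: "y \<in> V" "n = degree E y" by auto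
    have "(SOME z. z \<in> orbit V E y) \<in> orbit V E y" by (rule someI[of _ y]) (rule orbit_refl)
    then have "degree E (SOME z. z \<in> orbit V E y) = n"
      using automorphism_degree[OF assms(1,2) _ y(1)] y(2) by (auto simp: orbit_def)
    with y(1) show "n \<in> (\<lambda>O'. degree E (SOME y. y \<in> O')) ` orbits V E"
      by (force simp: orbits_eq)
  qed
  then have "finite (degree E ` V)"
    using assms(3) by (meson finite_imageI finite_subset quasi_transitive_def)
  with assms(4) show ?thesis by (simp add: max_degree_def)
qed

text \<open>
  An increasing sequence of unions of orbits gains at least one orbit whenever it is not stationary.
\<close>

lemma invariant_chain_exhausts:
  fixes S :: "nat \<Rightarrow> 'a set"
  assumes fin: "finite (orbits V E)"
    and sub: "\<And>n. S n \<subseteq> V"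
    and ne: "S 0 \<noteq> {}"
    and mono: "\<And>n. S n \<subseteq> S (Suc n)"
    and inv: "\<And>n x. x \<in> S n \<Longrightarrow> orbit V E x \<subseteq> S n"
    and stationary: "\<And>n. S n = S (Suc n) \<Longrightarrow> S n = V"
  shows "S (card (orbits V E)) = V"
proof -
  have finC: "finite (orbit V E ` S n)" for n
    using fin sub by (auto simp: orbits_eq intro: finite_subset[OF image_mono])
  have grow: "S n = V \<or> Suc n \<le> card (orbit V E ` S n)" for n
  proof (induction n)
    case 0
    have "card (orbit V E ` S 0) > 0" using finC ne by (simp add: card_gt_0_iff)
    then show ?case by simp
  next
    case (Suc n)
    show ?case
    proof (cases "S n = S (Suc n)")
      case True
      with stationary show ?thesis by metis
    next
      case False
      then obtain x where x: "x \<in> S (Suc n)" "x \<notin> S n" using mono by blast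
      then have "S n \<noteq> V" using sub by blast
      with Suc have n: "Suc n \<le> card (orbit V E ` S n)" by simp
      have "orbit V E x \<notin> orbit V E ` S n"
        using x(2) inv orbit_refl by fastforce
      with x(1) mono have "orbit V E ` S n \<subset> orbit V E ` S (Suc n)" by blast
      then have "card (orbit V E ` S n) < card (orbit V E ` S (Suc n))"
        using finC by (rule psubset_card_mono[rotated])
      with n show ?thesis by simp
    qed
  qed
  have "card (orbit V E ` S n) \<le> card (orbits V E)" for n
    using fin sub by (auto simp: orbits_eq intro: card_mono image_mono)
  with grow[of "card (orbits V E)"] show ?thesis by (meson not_less_eq_eq)
qed

section \<open>Odd closed walks\<close>

text \<open>Without odd closed walks, the parity of the length of a walk from a fixed vertex depends only
  on its endpoint and gives a bipartition.\<close>

lemma odd_closed_walk_exists: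
  assumes "graph V E" "connected_graph V E" "\<not> bipartite V E"
  obtains n x where "odd n" "x \<in> V" "(x, x) \<in> E ^^ n"
proof (rule ccontr)
  assume *: "\<not> thesis"
  note no_odd = that
  have sym: "sym E" and EV: "E \<subseteq> V \<times> V" using assms(1) by (auto simp: graph_def)
  have "V \<noteq> {}"
  proof
    assume "V = {}"
    with EV have "bipartite V E" by (auto simp: bipartite_def)
    with assms(3) show False by simp
  qed
  then obtain r where r: "r \<in> V" by auto
  define P where "P b = {y \<in> V. \<exists>n. even n = b \<and> (r, y) \<in> E ^^ n}" for b
  have "P True \<union> P False = V"
  proof
    show "V \<subseteq> P True \<union> P False"
    proof
      fix y assume y: "y \<in> V"
      then obtain n where "(r, y) \<in> E ^^ n" using connected_walk_exists[OF assms(2) r] by metis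
      with y show "y \<in> P True \<union> P False" by (auto simp: P_def)
    qed
  qed (auto simp: P_def)
  moreover have "P True \<inter> P False = {}"
  proof (rule ccontr)
    assume "P True \<inter> P False \<noteq> {}"
    then obtain y m n where "even m" "odd n" "(r, y) \<in> E ^^ m" "(r, y) \<in> E ^^ n"
      by (auto simp: P_def)
    then have "(r, r) \<in> E ^^ (m + n)" "odd (m + n)"
      using relpow_trans relpow_sym[OF sym] by (metis, simp)
    with no_odd r * show False by blast
  qed
  moreover have "y \<in> P (\<not> b)" if "x \<in> P b" "(x, y) \<in> E" for x y b
  proof -
    from that(1) obtain n where "even n = b" "(r, x) \<in> E ^^ n" by (auto simp: P_def)
    with that(2) have "even (Suc n) = (\<not> b)" "(r, y) \<in> E ^^ Suc n" by auto
    with that(2) EV show ?thesis unfolding P_def by blast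
  qed
  then have "\<forall>(x, y)\<in>E. x \<in> P True \<and> y \<in> P False \<or> x \<in> P False \<and> y \<in> P True"
    using \<open>P True \<union> P False = V\<close> EV by fastforce
  ultimately have "bipartite V E" unfolding bipartite_def by blast
  with assms(3) show False by simp
qed

lemma odd_girth_attained:
  assumes "graph V E" "connected_graph V E" "\<not> bipartite V E"
  obtains g x where "odd_girth V E = enat g" "odd g" "x \<in> V" "(x, x) \<in> E ^^ g"
proof -
  let ?G = "{enat n | n. odd n \<and> (\<exists>x\<in>V. (x, x) \<in> E ^^ n)}"
  obtain n x where n: "odd n" "x \<in> V" "(x, x) \<in> E ^^ n" by (rule odd_closed_walk_exists[OF assms])
  then have G: "enat n \<in> ?G" using n by (intro CollectI exI[of _ n] conjI refl bexI[of _ x])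
  have "Inf ?G = (LEAST m. m \<in> ?G)" unfolding Inf_enat_def by (rule if_not_P) (use G in blast)
  moreover have "(LEAST m. m \<in> ?G) \<in> ?G" using G by (rule LeastI)
  ultimately have "odd_girth V E \<in> ?G" unfolding odd_girth_def by (rule ssubst)
  then show thesis using that by (elim CollectE exE conjE bexE)
qed

text \<open>
  Extending a closed walk at \<open>x\<close> by an edge at both ends, or by an edge traversed back and forth,
  lengthens it by two. Hence the vertices on a closed walk of length \<open>g + 2 * n\<close> form an increasing
  chain that absorbs neighbours.
\<close>

lemma odd_closed_walk_everywhere:
  assumes G: "graph V E" "connected_graph V E" "quasi_transitive V E"
    and g: "odd g" "x \<in> V" "(x, x) \<in> E ^^ g"
    and y: "y \<in> V"
  shows "(y, y) \<in> E ^^ (g + 2 * card (orbits V E))"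
proof -
  define S where "S n = {y \<in> V. (y, y) \<in> E ^^ (g + 2 * n)}" for n
  have sym: "sym E" and EV: "E \<subseteq> V \<times> V" using G(1) by (auto simp: graph_def)
  have neighbour: "w \<in> S (Suc n)" if "z \<in> S n" "(z, w) \<in> E" for z w n
  proof -
    have "(w, z) \<in> E" using that(2) sym by (rule symD[rotated])
    then have "(w, z) \<in> E ^^ Suc (g + 2 * n)"
      using that(1) by (intro relpow_Suc_I2) (auto simp: S_def)
    then have "(w, w) \<in> E ^^ Suc (Suc (g + 2 * n))" using that(2) by (rule relpow_Suc_I)
    with that(2) EV show ?thesis by (auto simp: S_def)
  qed
  have mono: "S n \<subseteq> S (Suc n)" for n
  proof
    fix z assume z: "z \<in> S n"
    \<comment> \<open>A closed walk of odd, hence positive, length provides an edge at \<open>z\<close>.\<close>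
    obtain m where "g + 2 * n = Suc m" using g(1) by (cases "g + 2 * n") auto
    with z have "(z, z) \<in> E ^^ Suc m" by (simp add: S_def)
    then obtain w where w: "(z, w) \<in> E" by (meson relpow_Suc_D2)
    then have "(w, z) \<in> E" using sym by (rule symD[rotated])
    with w have "(z, z) \<in> E ^^ 2" by (auto simp: numeral_2_eq_2)
    with z show "z \<in> S (Suc n)"
      using relpow_trans[of z z "g + 2 * n" E z 2] by (simp add: S_def)
  qed
  have "S (card (orbits V E)) = V"
  proof (rule invariant_chain_exhausts)
    show "orbit V E z \<subseteq> S n" if "z \<in> S n" for n z
    proof
      fix w assume "w \<in> orbit V E z"
      then obtain f where f: "f \<in> automorphisms V E" "w = f z" by (auto simp: orbit_def)
      then have "w \<in> V"
        using that by (auto simp: S_def automorphisms_def self_isometries_def bij_betw_def)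
      with that f automorphism_relpow[OF G(1,2) f(1)] show "w \<in> S n" by (auto simp: S_def)
    qed
    show "S n = V" if eq: "S n = S (Suc n)" for n
    proof
      show "V \<subseteq> S n"
      proof
        fix w assume "w \<in> V"
        have "x \<in> S n" for n by (induction n) (use g mono in \<open>auto simp: S_def\<close>)
        moreover have "(x, w) \<in> E\<^sup>*" using G(2) g(2) \<open>w \<in> V\<close> by (auto simp: connected_graph_def)
        from this show "w \<in> S n"
        proof induction
          case base
          show ?case by fact
        next
          case (step a b)
          with neighbour eq show ?case by blast
        qed
      qed
    qed (auto simp: S_def)
  qed (use G mono g in \<open>auto simp: S_def quasi_transitive_def\<close>)
  with y show ?thesis by (auto simp: S_def)
qed

section \<open>Defective vertices\<close>

text \<open>The vertices at which \<open>A\<close> and \<open>B\<close> fail to be the two sides of a bipartition.\<close>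

definition defective :: "('a \<times> 'a) set \<Rightarrow> 'a set \<Rightarrow> 'a set \<Rightarrow> 'a set" where
  "defective E A B = {u \<in> A. \<not> E `` {u} \<subseteq> B} \<union> {u \<in> B. \<not> E `` {u} \<subseteq> A}"

lemma defective_commute: "defective E A B = defective E B A"
  by (auto simp: defective_def)

lemma walk_alternates:
  assumes "(x, y) \<in> E ^^ n" "x \<in> A"
    and "\<And>i u. i < n \<Longrightarrow> (x, u) \<in> E ^^ i \<Longrightarrow> u \<notin> defective E A B"
  shows "y \<in> (if even n then A else B)"
  using assms(1,3)
proof (induction n arbitrary: y)
  case 0
  with assms(2) show ?case by simp
next
  case (Suc n)
  then obtain z where z: "(x, z) \<in> E ^^ n" "(z, y) \<in> E" by auto
  have "z \<in> (if even n then A else B)"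
    by (rule Suc.IH[OF z(1)]) (rule Suc.prems(2)[OF less_SucI])
  moreover have "z \<notin> defective E A B" using Suc.prems(2) z(1) by blast
  ultimately show ?case using z(2) by (auto simp: defective_def split: if_splits)
qed

lemma defective_vertex_nearby:
  assumes "A \<inter> B = {}" "odd n" "(x, x) \<in> E ^^ n" "x \<in> A \<union> B"
  shows "\<exists>i<n. \<exists>u\<in>defective E A B. (x, u) \<in> E ^^ i"
proof (rule ccontr)
  assume "\<not> ?thesis"
  then have no_defect: "u \<notin> defective E A B" if "i < n" "(x, u) \<in> E ^^ i" for i u
    using that by auto
  from assms(4) show False
  proof
    assume x: "x \<in> A"
    then have "x \<in> (if even n then A else B)"
      by (rule walk_alternates[OF assms(3)]) (rule no_defect)
    with x assms(1,2) show False by auto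
  next
    assume x: "x \<in> B"
    then have "x \<in> (if even n then B else A)"
      by (rule walk_alternates[OF assms(3)]) (use no_defect defective_commute[of E A B] in simp)
    with x assms(1,2) show False by auto
  qed
qed

lemma edges_between_commute:
  assumes "sym E"
  shows "edges_between E A B = edges_between E B A"
proof -
  have "edge_weight E x y = edge_weight E y x" for x y
    using assms by (auto simp: edge_weight_def dest: symD)
  then show ?thesis unfolding edges_between_def by (subst sum.swap) simp
qed

text \<open>A vertex of \<open>A\<close> sends at most all of its edges to \<open>B\<close>, and one fewer if it is defective.\<close>

lemma edges_between_deficit:
  assumes "finite A" "finite B" "\<And>x. x \<in> A \<Longrightarrow> finite (E `` {x})"
  shows "edges_between E A B + card {u \<in> A. \<not> E `` {u} \<subseteq> B} \<le> vol E A"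
proof -
  have "card {u \<in> A. \<not> E `` {u} \<subseteq> B} = (\<Sum>x\<in>A. if \<not> E `` {x} \<subseteq> B then 1 else 0)"
    using assms(1) by (subst sum.If_cases) (auto simp: Int_def)
  then have "edges_between E A B + card {u \<in> A. \<not> E `` {u} \<subseteq> B}
      = (\<Sum>x\<in>A. (\<Sum>y\<in>B. edge_weight E x y) + (if \<not> E `` {x} \<subseteq> B then 1 else 0))"
    by (simp add: edges_between_def sum.distrib)
  also have "\<dots> \<le> (\<Sum>x\<in>A. degree E x)"
  proof (rule sum_mono)
    fix x assume x: "x \<in> A"
    have "(\<Sum>y\<in>B. edge_weight E x y) = card (E `` {x} \<inter> B)"
      using assms(2) unfolding edge_weight_def
      by (subst sum.If_cases) (auto intro: arg_cong[where f = card])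
    moreover have "card (E `` {x}) = card (E `` {x} \<inter> B) + card (E `` {x} - B)"
      using assms(3)[OF x] by (metis card_Diff_subset_Int card_mono finite_Int inf_le1 le_add_diff_inverse)
    moreover have "card (E `` {x} - B) \<ge> 1" if "\<not> E `` {x} \<subseteq> B"
    proof -
      have "E `` {x} - B \<noteq> {}" using that by blast
      then show ?thesis using assms(3)[OF x] by (simp add: Suc_le_eq card_gt_0_iff)
    qed
    ultimately show "(\<Sum>y\<in>B. edge_weight E x y) + (if \<not> E `` {x} \<subseteq> B then 1 else 0) \<le> degree E x"
      by (simp add: degree_eq_card)
  qed
  finally show ?thesis by (simp add: vol_def)
qed

lemma quotient_deficit:
  assumes G: "graph V E" "locally_finite V E"
    and AB: "A \<subseteq> V" "B \<subseteq> V" "A \<inter> B = {}" "finite A" "finite B"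
  shows "2 * edges_between E A B + card (defective E A B) \<le> vol E A + vol E B"
proof -
  have fin: "finite (E `` {x})" if "x \<in> A \<union> B" for x
    using that G(2) AB by (auto simp: locally_finite_def)
  have "edges_between E B A = edges_between E A B"
    using G(1) edges_between_commute by (auto simp: graph_def)
  moreover have "card (defective E A B)
      = card {u \<in> A. \<not> E `` {u} \<subseteq> B} + card {u \<in> B. \<not> E `` {u} \<subseteq> A}"
    unfolding defective_def using AB by (intro card_Un_disjoint) auto
  ultimately show ?thesis
    using edges_between_deficit[of A B E] edges_between_deficit[of B A E] fin AB by simp
qed

text \<open>Each vertex of \<open>A \<union> B\<close> is reached from a defective one in fewer than \<open>L\<close> steps.\<close>

lemma vol_le_card_defective:
  assumes G: "graph V E" "locally_finite V E"
    and d: "\<And>x. x \<in> V \<Longrightarrow> degree E x \<le> d"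
    and L: "odd L" "\<And>x. x \<in> V \<Longrightarrow> (x, x) \<in> E ^^ L"
    and AB: "A \<subseteq> V" "B \<subseteq> V" "A \<inter> B = {}" "finite A" "finite B"
  shows "vol E A + vol E B \<le> d * (\<Sum>i<L. d ^ i) * card (defective E A B)"
proof -
  let ?W = "defective E A B"
  have W: "finite ?W" "?W \<subseteq> V" using AB by (auto simp: defective_def)
  have ball: "finite ((E ^^ i) `` {u})" "card ((E ^^ i) `` {u}) \<le> d ^ i" if "u \<in> ?W" for u i
    using card_relpow_Image_le[OF G d] that W(2) by auto
  let ?R = "\<Union>u\<in>?W. \<Union>i<L. (E ^^ i) `` {u}"
  have sub: "A \<union> B \<subseteq> ?R"
  proof
    fix x assume x: "x \<in> A \<union> B"
    then obtain i u where "i < L" "u \<in> ?W" "(x, u) \<in> E ^^ i"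
      using defective_vertex_nearby[OF AB(3) L(1)] L(2) AB(1,2) by blast
    moreover have "sym E" using G(1) by (simp add: graph_def)
    ultimately show "x \<in> ?R" using relpow_sym by fastforce
  qed
  have "card (A \<union> B) \<le> card ?R"
    using sub W(1) ball(1) by (intro card_mono) auto
  also have "\<dots> \<le> (\<Sum>u\<in>?W. card (\<Union>i<L. (E ^^ i) `` {u}))"
    using W(1) by (rule card_UN_le)
  also have "\<dots> \<le> (\<Sum>u\<in>?W. \<Sum>i<L. d ^ i)"
  proof (rule sum_mono)
    fix u assume u: "u \<in> ?W"
    have "card (\<Union>i<L. (E ^^ i) `` {u}) \<le> (\<Sum>i<L. card ((E ^^ i) `` {u}))"
      by (rule card_UN_le) simp
    also have "\<dots> \<le> (\<Sum>i<L. d ^ i)" using ball(2)[OF u] by (rule sum_mono)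
    finally show "card (\<Union>i<L. (E ^^ i) `` {u}) \<le> (\<Sum>i<L. d ^ i)" .
  qed
  also have "\<dots> = (\<Sum>i<L. d ^ i) * card ?W" by simp
  finally have U: "card (A \<union> B) \<le> (\<Sum>i<L. d ^ i) * card ?W" .
  have "vol E A + vol E B = (\<Sum>x\<in>A \<union> B. degree E x)"
    using AB by (simp add: vol_def sum.union_disjoint)
  also have "\<dots> \<le> (\<Sum>x\<in>A \<union> B. d)" using AB by (intro sum_mono d) auto
  also have "\<dots> = d * card (A \<union> B)" by simp
  also have "\<dots> \<le> d * ((\<Sum>i<L. d ^ i) * card ?W)" using U by (rule mult_le_mono2)
  finally show ?thesis by (simp add: mult.assoc)
qed

section \<open>The bound on the dual Cheeger constant\<close>

lemma dual_cheeger_le: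
  assumes G: "graph V E" "infinite V" "locally_finite V E"
    and d: "\<And>x. x \<in> V \<Longrightarrow> degree E x \<le> d"
    and L: "odd L" "\<And>x. x \<in> V \<Longrightarrow> (x, x) \<in> E ^^ L"
  shows "dual_cheeger V E \<le> 1 - 1 / (1 + real (d * (\<Sum>i<L. d ^ i)))"
proof -
  let ?Q = "{2 * real (edges_between E A B) / (real (vol E A) + real (vol E B)) | A B.
      A \<subseteq> V \<and> B \<subseteq> V \<and> A \<inter> B = {} \<and> A \<noteq> {} \<and> B \<noteq> {} \<and> finite A \<and> finite B}"
  have "?Q \<noteq> {}"
  proof -
    obtain a where "a \<in> V" using G(2) by fastforce
    moreover have "V - {a} \<noteq> {}" using infinite_remove[OF G(2)] by (metis finite.emptyI)
    then obtain b where "b \<in> V - {a}" by blast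
    ultimately have "2 * real (edges_between E {a} {b}) / (real (vol E {a}) + real (vol E {b})) \<in> ?Q"
      by (intro CollectI exI[of _ "{a}"] exI[of _ "{b}"] conjI refl) auto
    then have "\<exists>q. q \<in> ?Q" by (rule exI)
    then show ?thesis by (simp only: ex_in_conv not_False_eq_True)
  qed
  moreover have "q \<le> 1 - 1 / (1 + real (d * (\<Sum>i<L. d ^ i)))" if "q \<in> ?Q" for q
  proof -
    from that obtain A B where q: "q = 2 * real (edges_between E A B) / (real (vol E A) + real (vol E B))"
      and AB: "A \<subseteq> V" "B \<subseteq> V" "A \<inter> B = {}" "finite A" "finite B" by blast
    define v where "v = real (vol E A) + real (vol E B)"
    define w where "w = real (card (defective E A B))"
    define M where "M = real (d * (\<Sum>i<L. d ^ i))"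
    have M: "M \<ge> 0" unfolding M_def by (rule of_nat_0_le_iff)
    have w: "w \<ge> 0" and v: "v \<ge> 0" by (simp_all add: w_def v_def)
    have "real (2 * edges_between E A B + card (defective E A B)) \<le> real (vol E A + vol E B)"
      using quotient_deficit[OF G(1,3) AB] by (rule of_nat_mono)
    then have 1: "2 * real (edges_between E A B) \<le> v - w" by (simp add: v_def w_def)
    have "real (vol E A + vol E B) \<le> real (d * (\<Sum>i<L. d ^ i) * card (defective E A B))"
      using vol_le_card_defective[OF G(1,3) d L AB] by (rule of_nat_mono)
    then have 2: "v \<le> M * w" by (simp add: v_def w_def M_def)
    have "q \<le> 1 - 1 / (1 + M)"
    proof (cases "v = 0")
      case True
      \<comment> \<open>Then the quotient is \<open>0 / 0 = 0\<close>.\<close>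
      then have "q = 0" using q by (simp add: v_def)
      with M show ?thesis by simp
    next
      case False
      have "v \<le> (1 + M) * w" using 2 w by (simp add: algebra_simps)
      then have "v / (1 + M) \<le> w" using M by (simp add: divide_le_eq mult.commute)
      with 1 have "2 * real (edges_between E A B) \<le> (1 - 1 / (1 + M)) * v"
        by (simp add: algebra_simps)
      then show ?thesis
        using False v q by (simp add: v_def[symmetric] pos_divide_le_eq)
    qed
    then show ?thesis unfolding M_def .
  qed
  ultimately show ?thesis unfolding dual_cheeger_def by (rule cSup_least)
qed

theorem theorem9p1:
  shows "\<exists>\<delta> :: nat \<Rightarrow> nat \<Rightarrow> enat \<Rightarrow> real.
    (\<forall>d k g. \<delta> d k g > 0) \<and>
    (\<forall>(V :: 'a set) E.
       graph V E \<and> infinite V \<and> locally_finite V E \<and> connected_graph V E \<and>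
       quasi_transitive V E \<and> \<not> bipartite V E \<longrightarrow>
       dual_cheeger V E \<le> 1 - \<delta> (max_degree V E) (card (orbits V E)) (odd_girth V E))"
proof -
  \<comment> \<open>This is \<open>1 / (1 + d * N)\<close> with \<open>L = g + 2 * k\<close>; the summand 1 keeps \<open>\<delta>\<close> positive also at
    \<open>d = 0\<close>.\<close>
  define \<delta> :: "nat \<Rightarrow> nat \<Rightarrow> enat \<Rightarrow> real" where
    "\<delta> d k g = 1 / (1 + real (d * (\<Sum>i<the_enat g + 2 * k. d ^ i)))" for d k g
  have "\<delta> d k g > 0" for d k g
    unfolding \<delta>_def by (intro divide_pos_pos add_pos_nonneg zero_less_one of_nat_0_le_iff)
  moreover have "dual_cheeger V E \<le> 1 - \<delta> (max_degree V E) (card (orbits V E)) (odd_girth V E)"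
    if G: "graph V E" "infinite V" "locally_finite V E" "connected_graph V E" "quasi_transitive V E"
      "\<not> bipartite V E" for V :: "'a set" and E
  proof -
    obtain g x where g: "odd_girth V E = enat g" "odd g" "x \<in> V" "(x, x) \<in> E ^^ g"
      using odd_girth_attained[OF G(1,4,6)] by metis
    have "(y, y) \<in> E ^^ (g + 2 * card (orbits V E))" if "y \<in> V" for y
      using odd_closed_walk_everywhere[OF G(1,4,5) g(2-4) that] .
    then have "dual_cheeger V E \<le>
        1 - 1 / (1 + real (max_degree V E * (\<Sum>i<g + 2 * card (orbits V E). max_degree V E ^ i)))"
      using g(2) degree_le_max_degree[OF G(1,4,5)] by (intro dual_cheeger_le[OF G(1-3)]) auto
    then show ?thesis by (simp add: \<delta>_def g(1))
  qed
  ultimately show ?thesis by blast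
qed

end
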